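(* Consider the multi-agent system, the controller, the time-varying state transformation $\tilde e_s^i=h_s^i(e_s^i,\mu)$, the transformed error system and Conditions $C_1$, $C_2'$, $C_3'$ described in the context. Suppose the closed-loop system after the state transformation satisfies $C_1$, $C_2'$ and $C_3'$, with, for every $i\in\mathcal{V}$, $$\max\{\gamma_\zeta(s),\tilde\gamma_\varsigma^i(s),\tilde\gamma_u^i(s)\}=\mathcal{S}\big[1/\varrho_r(c,s)\big],$$ where $\varrho_r(c,s)=\underline{\alpha}_r^{-1}\big(c\,\exp(-\int_0^s\tau^{-2}\tilde\alpha_r(\tau)\,\mathrm{d}\tau)\big)$, $c\ge0$, and $$\tilde\sigma_{\tilde d}^i(s)=\mathcal{S}\big[\exp(c)\tilde\alpha_{\tilde s}^i(s)\big],\qquad \tilde\sigma_{\tilde r}^i(s)=\mathcal{S}\big[\tilde\alpha_{\tilde s}^i(s)/\sigma_{\tilde r}^i(\varrho_r(c,s))\big].$$ Then the distributed prescribed-time convex optimization (DPTCO) problem is solved for any bounded initial condition; that is, $\lim_{t\to T+t_0}(y^i(t)-z^* )=0$ for all $i\in\mathcal{V}$, and $x^i(t),y^i(t),u^i(t)$ are bounded for $t\in\mathcal{T}_p$, $i\in\mathcal{V}$.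
   Context: **Time and gains.** $t_0$ is the initial time, $T>0$ an arbitrary prescribed time, $\mathcal{T}_p=[t_0,T+t_0)$, $\mu=\mu(t)=1/(T+t_0-t)$ (so $\dot\mu=\mu^2$), which takes values in $\mathbb{R}_p=[1/T,\infty)$ on $\mathcal{T}_p$. **Function classes.** $\mathcal{K}_\infty$ is the usual class of continuous strictly increasing unbounded functions on $[0,\infty)$ vanishing at $0$; for $\alpha\in\mathcal{K}_\infty$, $\alpha^{-1}$ denotes the inverse function. A function $\alpha:[0,\infty)\to[a,\infty)$ is in $\mathcal{K}_\infty^e$ if it is strictly increasing and $\alpha(0)=a\ge0$. For $x_1:\mathbb{R}_{\ge0}\to\mathbb{R}_{\ge0}$ and $x_2:\mathbb{R}_{\ge0}\times\mathbb{R}_{\ge0}\to\mathbb{R}_{\ge0}$, $x_1(s)=\mathcal{S}[x_2(c,s)]$ means: for any $c<\infty$, $\sup_{s\in\mathbb{R}_{\ge0}}[x_1(s)/x_2(c,s)]<\infty$. **Lyapunov notation.** $V(x)\sim\{\underline\alpha,\bar\alpha,\tilde\alpha\,|\,\dot x=f(x,\mu)\}$ means: $V$ is continuously differentiable, $\underline\alpha,\bar\alpha,\tilde\alpha\in\mathcal{K}_\infty$, $\underline\alpha(\|x\|)\le V(x)\le\bar\alpha(\|x\|)$, and along the system $\dot V\le-\tilde\alpha(\mu)V$, for all $x$ and $t\in\mathcal{T}_p$. $V(x)\sim\{\underline\alpha,\bar\alpha,\tilde\alpha,[\sigma_1,\tilde\sigma_1],\dots,[\sigma_k,\tilde\sigma_k]\,|\,\dot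 x=f(x,d_1,\dots,d_k,\mu)\}$ means the same except that $\dot V\le-\tilde\alpha(\mu)V+\sum_{j=1}^k\tilde\sigma_j(\mu)\sigma_j(\|d_j\|)$ with $\tilde\sigma_j\in\mathcal{K}_\infty$ and $\sigma_j\in\mathcal{K}_\infty^e$. **Agents.** For $i\in\mathcal{V}=\{1,\dots,N\}$: $\dot x^i=g_x^i(x^i,y^i,u^i,d^i(t))$, $\dot y^i=g_y^i(x^i,y^i,u^i,d^i(t))$, with state $x^i\in\mathbb{R}^n$, output $y^i\in\mathbb{R}^m$, input $u^i\in\mathbb{R}^q$, uncertainty/disturbance $d^i:[t_0,\infty)\to\mathbb{D}$ with $\mathbb{D}\subset\mathbb{R}^{n_d}$ compact; $g_x^i,g_y^i$ are smooth with $g_x^i(0,y^i,0,d^i)=0$, $g_y^i(0,y^i,0,d^i)=0$. **Optimization problem.** Minimize $\sum_{i=1}^Nf^i(y^i)$ subject to $y^i=y^j$ for all $i\ne j$. Standing assumptions: the undirected communication graph, with weighted adjacency matrix $[a_{ij}]$, is connected; each $f^i:\mathbb{R}^m\to\mathbb{R}$ is differentiable, known (with its gradient) only to agent $i$, with $(\nabla f^i(x)-\nabla f^i(y))^T(x-y)\ge\rho_c\|x-y\|^2$ and $\|\nabla f^i(x)-\nabla f^i(y)\|\le\varrho_c\|x-y\|$, $\rho_c,\varrho_c>0$; the optimal value is finite and the optimum set is nonempty and compact. The optimum is $1_N\otimes z^*$ with $z^*\in\mathbb{R}^m$. **DPTCO problem.** For any prescribed $T>0$, using only local information exchange, find controllers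 $u^i$ such that the outputs satisfy $\lim_{t\to T+t_0}(y^i(t)-z^* )=0$ for all $i$, irrespective of initial values and of control parameters other than $T$, with $x^i(t),y^i(t),u^i(t)$ bounded on $\mathcal{T}_p$. **Controller.** $\dot\zeta^i=h_\zeta^i(\zeta^i,\chi^i,\mu)$, $\dot\varsigma^i=h_\varsigma^i(\varsigma^i,\zeta^i,\xi^i,\mu)$ with $\varsigma^i\in\mathbb{R}^{m_\varsigma}$, $u^i=h_u^i(\varsigma^i,\zeta^i,\xi^i,\mu)$, where $\chi^i=\sum_{j\in\mathcal{N}_i}a_{ij}(\zeta^j-\zeta^i)$, $\xi^i=[(x^i)^T,(y^i)^T]^T$, $\zeta^i=[(\varpi^i)^T,(p^i)^T]^T$. The $\zeta^i$-dynamics admits the equilibrium $\zeta^{*,i}=[(z^* )^T,(p_0^i(z^* ))^T]^T$ for a known function $p_0^i$. **Error system.** $e_\varpi^i=\varpi^i-z^*$, $e_p^i=p^i-p_0^i(z^* )$, $e^i=y^i-z^*$, $e_y^i=y^i-\varpi^i$, $e_s^i=[(x^i)^T,(e_y^i)^T,(\varsigma^i)^T]^T$, $e_r^i=[(e_\varpi^i)^T,(e_p^i)^T]^T$; $e_\varpi,e_p$ are the stacked vectors over $i$ and $e_r=[e_\varpi^T,e_p^T]^T$. The closed loop reads $\dot e_r=\tilde h_\zeta(e_r,\mu)$, $\dot e_s^i=g_c^i(e_s^i,e_r,d^i,\mu)$, $e^i=[0,I,0]e_s^i+[I,0]e_r^i$. **Time-varying state transformation.** $\tilde e_s^i=h_s^i(e_s^i,\mu)$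 with $h_s^i:\mathbb{R}^{n+m+m_\varsigma}\times\mathbb{R}_p\to\mathbb{R}^s$ differentiable (generally nonlinear). Then $\dot e_r=\tilde h_\zeta(e_r,\mu)$, $\dot{\tilde e}_s^i=\tilde h_s^i(\tilde e_s^i,e_r,d^i,\mu)=\frac{\partial h_s^i}{\partial e_s^i}g_c^i(e_s^i,e_r,d^i,\mu)+\frac{\partial h_s^i}{\partial\mu}\mu^2$, and the $\varsigma^i$-dynamics and the input are rewritten as $\dot\varsigma^i=\bar h_\varsigma^i(\tilde e_s^i,e_r,\mu)$, $u^i=\bar h_u^i(\tilde e_s^i,e_r,\mu)$. Put $\|\tilde e_s^i\|_{\mathcal{T}}=\sup_{t\in\mathcal{T}_p}\|\tilde e_s^i(t)\|$. **Conditions.** $C_1$: there is $V_r$ with $V_r(e_r)\sim\{\underline\alpha_r,\bar\alpha_r,\tilde\alpha_r\,|\,\dot e_r=\tilde h_\zeta(e_r,\mu)\}$. Moreover $\gamma_\zeta\in\mathcal{K}_\infty$ denotes a function with $\|\tilde h_\zeta(e_r,\mu)\|\le\gamma_\zeta(\mu)\|e_r\|$. $C_2'$: there is a time-varying state transformation $\tilde e_s^i=h_s^i(e_s^i,\mu)$, with $h_s^i:\mathbb{R}^{n+m+m_\varsigma}\times\mathbb{R}_p\to\mathbb{R}^s$ differentiable, such that for each $i\in\mathcal{V}$ there is $\tilde V_s^i$ with $\tilde V_s^i(\tilde e_s^i)\sim\{\underline\alpha_{\tilde s}^i,\bar\alpha_{\tilde s}^i,\tilde\alpha_{\tilde s}^i,[\sigma_{\tilde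 r}^i,\tilde\sigma_{\tilde r}^i],[\sigma_{\tilde d}^i,\tilde\sigma_{\tilde d}^i]\,|\,\dot{\tilde e}_s^i=\tilde h_s^i(\tilde e_s^i,e_r,d^i,\mu)\}$ (first pair for the input $e_r$, second for $d^i$), for some $\sigma_{\tilde r}^i\in\mathcal{K}_\infty$, $\sigma_{\tilde d}^i\in\mathcal{K}_\infty^e$. Moreover, boundedness of $\tilde e_s^i$ on $\mathcal{T}_p$ implies prescribed-time convergence of $e_s^i$ (i.e. $e_s^i(t)\to0$ as $t\to T+t_0$). $C_3'$: for each $i\in\mathcal{V}$ and $\mu\in\mathbb{R}_p$, $\|\bar h_\varsigma^i(\tilde e_s^i,e_r,\mu)\|\le\gamma_s^i(\|\tilde e_s^i\|_{\mathcal{T}})+\tilde\gamma_\varsigma^i(\mu)\|e_r\|$ and $\|\bar h_u^i(\tilde e_s^i,e_r,\mu)\|\le\tilde\gamma_s^i(\|\tilde e_s^i\|_{\mathcal{T}})+\tilde\gamma_u^i(\mu)\|e_r\|$, with $\gamma_s^i,\tilde\gamma_s^i\in\mathcal{K}_\infty^e$ and $\tilde\gamma_u^i,\tilde\gamma_\varsigma^i\in\mathcal{K}_\infty$. *)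

theory Defs
  imports "HOL-Analysis.Analysis"
begin

text \<open>Comparison functions are total on the reals; only their values on \<open>[0,\<infinity>)\<close> matter.\<close>

definition K_inf :: "(real \<Rightarrow> real) \<Rightarrow> bool" where
  "K_inf \<alpha> \<longleftrightarrow> continuous_on {0..} \<alpha> \<and> strict_mono_on {0..} \<alpha> \<and> \<alpha> 0 = 0
     \<and> (\<forall>M. \<exists>s\<ge>0. M < \<alpha> s)"

text \<open>As in the source, members of this class need be neither continuous nor unbounded.\<close>

definition K_inf_e :: "(real \<Rightarrow> real) \<Rightarrow> bool" where
  "K_inf_e \<alpha> \<longleftrightarrow> strict_mono_on {0..} \<alpha> \<and> 0 \<le> \<alpha> 0"

definition K_inv :: "(real \<Rightarrow> real) \<Rightarrow> real \<Rightarrow> real" where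
  "K_inv \<alpha> = the_inv_into {0..} \<alpha>"

text \<open>The relation \<open>x\<^sub>1(s) = \<S>[x\<^sub>2(c,s)]\<close>.  The convention \<open>x / 0 = 0\<close> is harmless where it is used
  below: \<open>1 / \<rho>(c,s)\<close> and \<open>\<alpha>(s) / \<sigma>(\<rho>(c,s))\<close> have a zero denominator only for \<open>c = 0\<close>, where they
  stand for \<open>\<infinity>\<close> and the quotient \<open>x\<^sub>1 / x\<^sub>2\<close> is \<open>0\<close> also by convention; otherwise \<open>x\<^sub>2\<close> vanishes
  only at the single point \<open>s = 0\<close>, where the quotients in question read \<open>0 / 0\<close>.\<close>

definition order_S :: "(real \<Rightarrow> real) \<Rightarrow> (real \<Rightarrow> real \<Rightarrow> real) \<Rightarrow> bool" where
  "order_S x1 x2 \<longleftrightarrow> (\<forall>c\<ge>0. bdd_above ((\<lambda>s. x1 s / x2 c s) ` {0..}))"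

text \<open>The decay function \<open>\<rho>\<^sub>r(c,s)\<close>, from the lower bound and the decay rate of a Lyapunov
  function.  It presupposes that the integral converges at \<open>0\<close>.  If it does not, the integral
  below is \<open>0\<close> and \<open>rho lo dr c\<close> is constant in \<open>s\<close>; then no class \<open>K_inf\<close> function is
  \<open>\<S>[1 / rho lo dr c s]\<close>, so a divergent integral never satisfies the growth conditions.\<close>

definition rho :: "(real \<Rightarrow> real) \<Rightarrow> (real \<Rightarrow> real) \<Rightarrow> real \<Rightarrow> real \<Rightarrow> real" where
  "rho lo dr c s = K_inv lo (c * exp (- integral {0..s} (\<lambda>\<tau>. dr \<tau> / \<tau>\<^sup>2)))"

text \<open>\<open>C\<^sup>k\<close> on an open set, through iterated directional derivatives (finite dimension).\<close>

primrec Ck_on :: "nat \<Rightarrow> ('a::euclidean_space \<Rightarrow> 'b::euclidean_space) \<Rightarrow> 'a set \<Rightarrow> bool" where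
  "Ck_on 0 f U \<longleftrightarrow> continuous_on U f"
| "Ck_on (Suc k) f U \<longleftrightarrow> (\<forall>x\<in>U. f differentiable at x)
     \<and> (\<forall>v. Ck_on k (\<lambda>x. frechet_derivative f (at x) v) U)"

text \<open>Smoothness on an arbitrary set is existence of a smooth extension to an open neighbourhood;
  the disturbance set is merely compact.\<close>

definition smooth_ext_on :: "('a::euclidean_space \<Rightarrow> 'b::euclidean_space) \<Rightarrow> 'a set \<Rightarrow> bool" where
  "smooth_ext_on f A \<longleftrightarrow>
     (\<exists>U g. open U \<and> A \<subseteq> U \<and> (\<forall>x\<in>A. g x = f x) \<and> (\<forall>k. Ck_on k g U))"

text \<open>\<open>R\<close> is the range of the gain \<open>\<mu>\<close>; quantifying over \<open>\<mu> \<in> R\<close> is quantifying over time.\<close>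

definition lyapunov_bounds ::
  "('a::euclidean_space \<Rightarrow> real) \<Rightarrow> (real \<Rightarrow> real) \<Rightarrow> (real \<Rightarrow> real) \<Rightarrow> (real \<Rightarrow> real) \<Rightarrow> bool" where
  "lyapunov_bounds V lo hi dr \<longleftrightarrow> Ck_on 1 V UNIV \<and> K_inf lo \<and> K_inf hi \<and> K_inf dr
     \<and> (\<forall>x. lo (norm x) \<le> V x \<and> V x \<le> hi (norm x))"

definition lyapunov ::
  "real set \<Rightarrow> ('a::euclidean_space \<Rightarrow> real) \<Rightarrow> (real \<Rightarrow> real) \<Rightarrow> (real \<Rightarrow> real) \<Rightarrow> (real \<Rightarrow> real)
     \<Rightarrow> ('a \<Rightarrow> real \<Rightarrow> 'a) \<Rightarrow> bool" where
  "lyapunov R V lo hi dr F \<longleftrightarrow> lyapunov_bounds V lo hi dr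
     \<and> (\<forall>x. \<forall>\<mu>\<in>R. frechet_derivative V (at x) (F x \<mu>) \<le> - dr \<mu> * V x)"

text \<open>Two inputs, the first unrestricted and the second with values in \<open>D\<close>.\<close>

definition lyapunov_inputs ::
  "real set \<Rightarrow> 'c set \<Rightarrow> ('a::euclidean_space \<Rightarrow> real)
     \<Rightarrow> (real \<Rightarrow> real) \<Rightarrow> (real \<Rightarrow> real) \<Rightarrow> (real \<Rightarrow> real)
     \<Rightarrow> (real \<Rightarrow> real) \<Rightarrow> (real \<Rightarrow> real) \<Rightarrow> (real \<Rightarrow> real) \<Rightarrow> (real \<Rightarrow> real)
     \<Rightarrow> ('a \<Rightarrow> 'b::real_normed_vector \<Rightarrow> 'c::real_normed_vector \<Rightarrow> real \<Rightarrow> 'a) \<Rightarrow> bool" where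
  "lyapunov_inputs R D V lo hi dr \<sigma>1 \<sigma>t1 \<sigma>2 \<sigma>t2 F \<longleftrightarrow> lyapunov_bounds V lo hi dr
     \<and> K_inf_e \<sigma>1 \<and> K_inf \<sigma>t1 \<and> K_inf_e \<sigma>2 \<and> K_inf \<sigma>t2
     \<and> (\<forall>x w. \<forall>d\<in>D. \<forall>\<mu>\<in>R. frechet_derivative V (at x) (F x w d \<mu>)
           \<le> - dr \<mu> * V x + \<sigma>t1 \<mu> * \<sigma>1 (norm w) + \<sigma>t2 \<mu> * \<sigma>2 (norm d))"

text \<open>Agents are indexed by the finite type \<open>'v\<close>.  Dimensions: \<open>'n\<close> state \<open>x\<close>, \<open>'m\<close> output \<open>y\<close>,
  \<open>'q\<close> input \<open>u\<close>, \<open>'d\<close> disturbance, \<open>'k\<close> controller state \<open>v\<close> (varsigma), \<open>'p\<close> auxiliary state \<open>p\<close>,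
  \<open>'s\<close> transformed error.  Vectors \<open>\<zeta> = (w, p)\<close> (with \<open>w\<close> for varpi), \<open>\<xi> = (x, y)\<close>,
  \<open>es = (x, y - w, v)\<close> of each agent and the stacked error \<open>er\<close> of all \<open>(w, p)\<close> are pairs, whose norm
  is the Euclidean norm of the stacked vector.\<close>

record ('v, 'n, 'm, 'q, 'd, 'k, 'p, 's) mas =
  init_time :: real
  horizon :: real
  dyn_x :: "'v \<Rightarrow> real^'n \<Rightarrow> real^'m \<Rightarrow> real^'q \<Rightarrow> real^'d \<Rightarrow> real^'n"
  dyn_y :: "'v \<Rightarrow> real^'n \<Rightarrow> real^'m \<Rightarrow> real^'q \<Rightarrow> real^'d \<Rightarrow> real^'m"
  dist_set :: "(real^'d) set"
  disturb :: "'v \<Rightarrow> real \<Rightarrow> real^'d"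
  adj :: "'v \<Rightarrow> 'v \<Rightarrow> real"
  cost :: "'v \<Rightarrow> real^'m \<Rightarrow> real"
  grad_cost :: "'v \<Rightarrow> real^'m \<Rightarrow> real^'m"
  zstar :: "real^'m"
  p_eq :: "'v \<Rightarrow> real^'m \<Rightarrow> real^'p"
  ctr_zeta :: "'v \<Rightarrow> (real^'m) \<times> (real^'p) \<Rightarrow> (real^'m) \<times> (real^'p) \<Rightarrow> real \<Rightarrow> (real^'m) \<times> (real^'p)"
  ctr_vs :: "'v \<Rightarrow> real^'k \<Rightarrow> (real^'m) \<times> (real^'p) \<Rightarrow> (real^'n) \<times> (real^'m) \<Rightarrow> real \<Rightarrow> real^'k"
  ctr_u :: "'v \<Rightarrow> real^'k \<Rightarrow> (real^'m) \<times> (real^'p) \<Rightarrow> (real^'n) \<times> (real^'m) \<Rightarrow> real \<Rightarrow> real^'q"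
  trans_s :: "'v \<Rightarrow> (real^'n) \<times> (real^'m) \<times> (real^'k) \<Rightarrow> real \<Rightarrow> real^'s"

definition time_dom where
  "time_dom S = {init_time S ..< horizon S + init_time S}"

definition gain where
  "gain S t = 1 / (horizon S + init_time S - t)"

definition gain_range where
  "gain_range S = {1 / horizon S ..}"

definition coupling ::
  "('v::finite, 'n::finite, 'm::finite, 'q::finite, 'd::finite, 'k::finite, 'p::finite, 's::finite) mas
     \<Rightarrow> ('v \<Rightarrow> (real^'m) \<times> (real^'p)) \<Rightarrow> 'v \<Rightarrow> (real^'m) \<times> (real^'p)" where
  "coupling S \<zeta> i = (\<Sum>j\<in>{j. adj S i j > 0}. adj S i j *\<^sub>R (\<zeta> j - \<zeta> i))"

definition zeta_eq where
  "zeta_eq S i = (zstar S, p_eq S i (zstar S))"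

definition agents_ok ::
  "('v::finite, 'n::finite, 'm::finite, 'q::finite, 'd::finite, 'k::finite, 'p::finite, 's::finite) mas
     \<Rightarrow> bool" where
  "agents_ok S \<longleftrightarrow> compact (dist_set S)
     \<and> (\<forall>i. \<forall>t\<ge>init_time S. disturb S i t \<in> dist_set S)
     \<and> (\<forall>i. smooth_ext_on (\<lambda>(x, y, u, d). dyn_x S i x y u d) (UNIV \<times> UNIV \<times> UNIV \<times> dist_set S))
     \<and> (\<forall>i. smooth_ext_on (\<lambda>(x, y, u, d). dyn_y S i x y u d) (UNIV \<times> UNIV \<times> UNIV \<times> dist_set S))
     \<and> (\<forall>i y. \<forall>d\<in>dist_set S. dyn_x S i 0 y 0 d = 0 \<and> dyn_y S i 0 y 0 d = 0)"

definition graph_ok where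
  "graph_ok S \<longleftrightarrow> (\<forall>i j. 0 \<le> adj S i j \<and> adj S i j = adj S j i) \<and> (\<forall>i. adj S i i = 0)
     \<and> (\<forall>i j. (i, j) \<in> {(k, l). adj S k l > 0}\<^sup>*)"

definition feasible :: "((real^'m)^'v) set" where
  "feasible = {y. \<forall>i j. y $ i = y $ j}"

definition total_cost ::
  "('v::finite, 'n::finite, 'm::finite, 'q::finite, 'd::finite, 'k::finite, 'p::finite, 's::finite) mas
     \<Rightarrow> (real^'m)^'v \<Rightarrow> real" where
  "total_cost S y = (\<Sum>i\<in>UNIV. cost S i (y $ i))"

definition optima where
  "optima S = {y \<in> feasible. \<forall>y'\<in>feasible. total_cost S y \<le> total_cost S y'}"

definition costs_ok ::
  "('v::finite, 'n::finite, 'm::finite, 'q::finite, 'd::finite, 'k::finite, 'p::finite, 's::finite) mas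
     \<Rightarrow> bool" where
  "costs_ok S \<longleftrightarrow> (\<forall>i z. GDERIV (cost S i) z :> grad_cost S i z)
     \<and> (\<exists>\<rho>c>0. \<exists>Lc>0. \<forall>i z z'.
          (grad_cost S i z - grad_cost S i z') \<bullet> (z - z') \<ge> \<rho>c * (norm (z - z'))\<^sup>2
        \<and> norm (grad_cost S i z - grad_cost S i z') \<le> Lc * norm (z - z'))
     \<and> bdd_below (total_cost S ` feasible) \<and> optima S \<noteq> {} \<and> compact (optima S)
     \<and> (\<chi> i. zstar S) \<in> optima S"

definition equilibrium_ok where
  "equilibrium_ok S \<longleftrightarrow>
     (\<forall>i. \<forall>\<mu>\<in>gain_range S. ctr_zeta S i (zeta_eq S i) (coupling S (zeta_eq S) i) \<mu> = 0)"

definition standing where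
  "standing S \<longleftrightarrow> 0 < horizon S \<and> agents_ok S \<and> graph_ok S \<and> costs_ok S \<and> equilibrium_ok S"

text \<open>Trajectories \<open>x, y, v, w, p\<close> of all agents, under the controller and defined on the whole
  interval \<open>[t\<^sub>0, t\<^sub>0 + T)\<close>, with arbitrary initial values.\<close>

definition zeta_sig where
  "zeta_sig w p t i = (w i t, p i t)"

definition input_sig where
  "input_sig S x y v w p i t =
     ctr_u S i (v i t) (zeta_sig w p t i) (x i t, y i t) (gain S t)"

definition trajectory ::
  "('v::finite, 'n::finite, 'm::finite, 'q::finite, 'd::finite, 'k::finite, 'p::finite, 's::finite) mas
     \<Rightarrow> ('v \<Rightarrow> real \<Rightarrow> real^'n) \<Rightarrow> ('v \<Rightarrow> real \<Rightarrow> real^'m) \<Rightarrow> ('v \<Rightarrow> real \<Rightarrow> real^'k)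
     \<Rightarrow> ('v \<Rightarrow> real \<Rightarrow> real^'m) \<Rightarrow> ('v \<Rightarrow> real \<Rightarrow> real^'p) \<Rightarrow> bool" where
  "trajectory S x y v w p \<longleftrightarrow> (\<forall>i. \<forall>t\<in>time_dom S.
      (x i has_vector_derivative
         dyn_x S i (x i t) (y i t) (input_sig S x y v w p i t) (disturb S i t)) (at t within time_dom S)
    \<and> (y i has_vector_derivative
         dyn_y S i (x i t) (y i t) (input_sig S x y v w p i t) (disturb S i t)) (at t within time_dom S)
    \<and> (v i has_vector_derivative
         ctr_vs S i (v i t) (zeta_sig w p t i) (x i t, y i t) (gain S t)) (at t within time_dom S)
    \<and> ((\<lambda>t. zeta_sig w p t i) has_vector_derivative
         ctr_zeta S i (zeta_sig w p t i) (coupling S (zeta_sig w p t) i) (gain S t))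
        (at t within time_dom S))"

definition er_sig ::
  "('v::finite, 'n::finite, 'm::finite, 'q::finite, 'd::finite, 'k::finite, 'p::finite, 's::finite) mas
     \<Rightarrow> ('v \<Rightarrow> real \<Rightarrow> real^'m) \<Rightarrow> ('v \<Rightarrow> real \<Rightarrow> real^'p) \<Rightarrow> real \<Rightarrow> ((real^'m)^'v) \<times> ((real^'p)^'v)" where
  "er_sig S w p t = (\<chi> i. w i t - zstar S, \<chi> i. p i t - p_eq S i (zstar S))"

definition es_sig where
  "es_sig x y v w i t = (x i t, y i t - w i t, v i t)"

definition est_sig where
  "est_sig S x y v w i t = trans_s S i (es_sig x y v w i t) (gain S t)"

text \<open>\<open>\<zeta>\<^sup>i\<close> and \<open>\<xi>\<^sup>i\<close> recovered from the errors.\<close>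

definition zeta_of ::
  "('v::finite, 'n::finite, 'm::finite, 'q::finite, 'd::finite, 'k::finite, 'p::finite, 's::finite) mas
     \<Rightarrow> ((real^'m)^'v) \<times> ((real^'p)^'v) \<Rightarrow> 'v \<Rightarrow> (real^'m) \<times> (real^'p)" where
  "zeta_of S er i = zeta_eq S i + (fst er $ i, snd er $ i)"

definition xi_of where
  "xi_of S es er i = (fst es, fst (snd es) + fst (zeta_of S er i))"

text \<open>Error system: \<open>err_r\<close> drives \<open>er\<close> and \<open>err_s S i\<close> (the field \<open>g\<^sub>c\<close> of agent \<open>i\<close>) drives \<open>es\<close>.\<close>

definition err_r ::
  "('v::finite, 'n::finite, 'm::finite, 'q::finite, 'd::finite, 'k::finite, 'p::finite, 's::finite) mas
     \<Rightarrow> ((real^'m)^'v) \<times> ((real^'p)^'v) \<Rightarrow> real \<Rightarrow> ((real^'m)^'v) \<times> ((real^'p)^'v)" where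
  "err_r S er \<mu> =
     (let F = (\<lambda>i. ctr_zeta S i (zeta_of S er i) (coupling S (zeta_of S er) i) \<mu>)
      in (\<chi> i. fst (F i), \<chi> i. snd (F i)))"

definition vs_of where
  "vs_of S i es er \<mu> = ctr_vs S i (snd (snd es)) (zeta_of S er i) (xi_of S es er i) \<mu>"

definition u_of where
  "u_of S i es er \<mu> = ctr_u S i (snd (snd es)) (zeta_of S er i) (xi_of S es er i) \<mu>"

definition err_s where
  "err_s S i es er d \<mu> =
     (let \<xi> = xi_of S es er i; u = u_of S i es er \<mu>
      in (dyn_x S i (fst \<xi>) (snd \<xi>) u d,
          dyn_y S i (fst \<xi>) (snd \<xi>) u d - fst (err_r S er \<mu>) $ i,
          vs_of S i es er \<mu>))"

text \<open>\<open>Fs\<close> is the field of the transformed error \<open>h\<^sub>s(es, \<mu>)\<close>; \<open>Hv\<close> and \<open>Hu\<close> are the \<open>v\<close>-dynamics and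
  the input rewritten in terms of it.  \<open>D\<close> is the total derivative of \<open>h\<^sub>s\<close> (one-sided in \<open>\<mu>\<close> at
  \<open>\<mu> = 1/T\<close>), so \<open>D (g\<^sub>c, \<mu>\<^sup>2)\<close> is the sum of the two partial derivative terms, as \<open>\<mu>' = \<mu>\<^sup>2\<close>.\<close>

definition transformed_system ::
  "('v::finite, 'n::finite, 'm::finite, 'q::finite, 'd::finite, 'k::finite, 'p::finite, 's::finite) mas
     \<Rightarrow> ('v \<Rightarrow> real^'s \<Rightarrow> ((real^'m)^'v) \<times> ((real^'p)^'v) \<Rightarrow> real^'d \<Rightarrow> real \<Rightarrow> real^'s)
     \<Rightarrow> ('v \<Rightarrow> real^'s \<Rightarrow> ((real^'m)^'v) \<times> ((real^'p)^'v) \<Rightarrow> real \<Rightarrow> real^'k)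
     \<Rightarrow> ('v \<Rightarrow> real^'s \<Rightarrow> ((real^'m)^'v) \<times> ((real^'p)^'v) \<Rightarrow> real \<Rightarrow> real^'q) \<Rightarrow> bool" where
  "transformed_system S Fs Hv Hu \<longleftrightarrow> (\<forall>i es. \<forall>\<mu>\<in>gain_range S.
      (\<exists>D. ((\<lambda>(e, m). trans_s S i e m) has_derivative D) (at (es, \<mu>) within UNIV \<times> gain_range S)
         \<and> (\<forall>er. \<forall>d\<in>dist_set S.
              Fs i (trans_s S i es \<mu>) er d \<mu> = D (err_s S i es er d \<mu>, \<mu>\<^sup>2)))
    \<and> (\<forall>er. Hv i (trans_s S i es \<mu>) er \<mu> = vs_of S i es er \<mu>
          \<and> Hu i (trans_s S i es \<mu>) er \<mu> = u_of S i es er \<mu>))"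

definition cond_C1 where
  "cond_C1 S lo hi dr \<gamma> \<longleftrightarrow> (\<exists>V. lyapunov (gain_range S) V lo hi dr (err_r S))
     \<and> K_inf \<gamma> \<and> (\<forall>er. \<forall>\<mu>\<in>gain_range S. norm (err_r S er \<mu>) \<le> \<gamma> \<mu> * norm er)"

definition cond_C2' where
  "cond_C2' S Fs lo hi dr \<sigma>r \<sigma>tr \<sigma>d \<sigma>td \<longleftrightarrow>
     (\<forall>i. K_inf (\<sigma>r i) \<and> K_inf_e (\<sigma>d i)
        \<and> (\<exists>V. lyapunov_inputs (gain_range S) (dist_set S) V (lo i) (hi i) (dr i)
                 (\<sigma>r i) (\<sigma>tr i) (\<sigma>d i) (\<sigma>td i) (Fs i)))
     \<and> (\<forall>x y v w p. trajectory S x y v w p \<longrightarrow>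
          (\<forall>i. bounded (est_sig S x y v w i ` time_dom S) \<longrightarrow>
               (es_sig x y v w i \<longlongrightarrow> 0) (at_left (horizon S + init_time S))))"

text \<open>The bounds involve the supremum of \<open>norm\<close> of the transformed error over a trajectory.  They are
  void when it is infinite, hence the boundedness premise.\<close>

definition sup_norm where
  "sup_norm S g = (SUP t\<in>time_dom S. norm (g t))"

definition cond_C3' where
  "cond_C3' S Hv Hu \<gamma>s \<gamma>ts \<gamma>v \<gamma>u \<longleftrightarrow>
     (\<forall>i. K_inf_e (\<gamma>s i) \<and> K_inf_e (\<gamma>ts i) \<and> K_inf (\<gamma>v i) \<and> K_inf (\<gamma>u i))
     \<and> (\<forall>x y v w p. trajectory S x y v w p \<longrightarrow>
          (\<forall>i. bounded (est_sig S x y v w i ` time_dom S) \<longrightarrow>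
             (\<forall>t\<in>time_dom S.
                norm (Hv i (est_sig S x y v w i t) (er_sig S w p t) (gain S t))
                  \<le> \<gamma>s i (sup_norm S (est_sig S x y v w i))
                    + \<gamma>v i (gain S t) * norm (er_sig S w p t)
              \<and> norm (Hu i (est_sig S x y v w i t) (er_sig S w p t) (gain S t))
                  \<le> \<gamma>ts i (sup_norm S (est_sig S x y v w i))
                    + \<gamma>u i (gain S t) * norm (er_sig S w p t))))"

definition dptco_solved where
  "dptco_solved S \<longleftrightarrow> (\<forall>x y v w p. trajectory S x y v w p \<longrightarrow>
     (\<forall>i. ((\<lambda>t. y i t - zstar S) \<longlongrightarrow> 0) (at_left (horizon S + init_time S))
        \<and> bounded (x i ` time_dom S) \<and> bounded (y i ` time_dom S)
        \<and> bounded (input_sig S x y v w p i ` time_dom S)))"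

end

theory Submission
  imports Defs
begin

text \<open>
  In terms of the gain \<open>\<mu>\<close>, the decay condition on the Lyapunov function of \<open>e\<^sub>r\<close> integrates to
  \<open>\<parallel>e\<^sub>r\<parallel> \<le> \<rho>\<^sub>r(c,\<mu>)\<close> for some \<open>c > 0\<close>, because \<open>\<mu>' = \<mu>\<^sup>2\<close>.  By the growth conditions every gain
  in question times \<open>\<parallel>e\<^sub>r\<parallel>\<close> stays bounded, so that \<open>e\<^sub>r\<close> tends to \<open>0\<close>, and the input terms in the
  Lyapunov inequality of the transformed error are absorbed in its decay rate:
  \<open>V' \<le> - \<alpha>(\<mu>) (V - K)\<close>.  Hence the transformed error is bounded.
\<close>

section \<open>Comparison functions\<close>

lemma K_inf_mono:
  assumes "K_inf \<alpha>" "0 \<le> r" "r \<le> s"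
  shows "\<alpha> r \<le> \<alpha> s"
  using assms unfolding K_inf_def strict_mono_on_def
  by (metis atLeast_iff order.order_iff_strict order_trans)

lemma K_inf_e_mono:
  assumes "K_inf_e \<alpha>" "0 \<le> r" "r \<le> s"
  shows "\<alpha> r \<le> \<alpha> s"
  using assms unfolding K_inf_e_def strict_mono_on_def
  by (metis atLeast_iff order.order_iff_strict order_trans)

lemma K_inf_pos:
  assumes "K_inf \<alpha>" "0 < r"
  shows "0 < \<alpha> r"
  using assms unfolding K_inf_def strict_mono_on_def
  by (metis atLeast_iff order.order_iff_strict)

lemma K_inf_nonneg:
  assumes "K_inf \<alpha>" "0 \<le> r"
  shows "0 \<le> \<alpha> r"
  using K_inf_mono[of \<alpha> 0 r] assms by (simp add: K_inf_def)

lemma K_inf_cancel: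
  assumes "K_inf \<alpha>" "0 \<le> r" "0 \<le> s" "\<alpha> r \<le> \<alpha> s"
  shows "r \<le> s"
  using assms unfolding K_inf_def strict_mono_on_def by (meson atLeast_iff linorder_not_less)

lemma K_inf_continuous_on:
  assumes "K_inf \<alpha>" "X \<subseteq> {0..}"
  shows "continuous_on X \<alpha>"
  using assms unfolding K_inf_def by (blast intro: continuous_on_subset)

lemma K_inf_at_top:
  assumes "K_inf \<alpha>"
  shows "filterlim \<alpha> at_top at_top"
  unfolding filterlim_at_top
proof
  fix M :: real
  obtain s where "s \<ge> 0" "M < \<alpha> s"
    using assms unfolding K_inf_def by blast
  then have "\<forall>r\<ge>s. M \<le> \<alpha> r"
    using K_inf_mono[OF assms] by fastforce
  then show "\<forall>\<^sub>F r in at_top. M \<le> \<alpha> r"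
    unfolding eventually_at_top_linorder by blast
qed

text \<open>Unboundedness and the intermediate value theorem make \<open>\<alpha>\<close> map
  \<open>{0..}\<close> onto itself, so the \<open>the_inv_into\<close> behind \<open>K_inv\<close>
  is a true inverse there.\<close>

lemma K_inv_props:
  assumes "K_inf \<alpha>" "0 \<le> v"
  shows "0 \<le> K_inv \<alpha> v" and "\<alpha> (K_inv \<alpha> v) = v"
proof -
  obtain s where s: "s \<ge> 0" "v < \<alpha> s"
    using assms unfolding K_inf_def by blast
  have "continuous_on {0..s} \<alpha>"
    by (rule K_inf_continuous_on[OF assms(1)]) auto
  then obtain r where r: "0 \<le> r" "\<alpha> r = v"
    using IVT'[of \<alpha> 0 v s] s assms by (auto simp: K_inf_def)
  have "inj_on \<alpha> {0..}"
    using assms(1) unfolding K_inf_def by (blast intro: strict_mono_on_imp_inj_on)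
  then have "K_inv \<alpha> v = r"
    unfolding K_inv_def using r by (metis atLeast_iff the_inv_into_f_f)
  with r show "0 \<le> K_inv \<alpha> v" and "\<alpha> (K_inv \<alpha> v) = v" by simp_all
qed

lemma le_K_inv:
  assumes "K_inf \<alpha>" "0 \<le> r" "\<alpha> r \<le> v"
  shows "r \<le> K_inv \<alpha> v"
proof -
  have "0 \<le> v" using K_inf_nonneg[OF assms(1,2)] assms(3) by simp
  then show ?thesis
    using K_inf_cancel[OF assms(1,2)] K_inv_props[OF assms(1)] assms(3) by simp
qed

lemma K_inv_pos:
  assumes "K_inf \<alpha>" "0 < v"
  shows "0 < K_inv \<alpha> v"
  using K_inv_props[of \<alpha> v] assms by (cases "K_inv \<alpha> v = 0") (auto simp: K_inf_def)

text \<open>For \<open>c = 0\<close> the value would be \<open>0\<close>; positivity for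
  \<open>c > 0\<close> lets the quotients in the growth conditions be cleared of
  denominators.\<close>

lemma rho_pos:
  assumes "K_inf lo" "0 < c"
  shows "0 < rho lo dr c s"
  unfolding rho_def using assms by (intro K_inv_pos) auto

lemma bounded_if_K_inf_bounded:
  assumes "K_inf \<alpha>" "\<And>t. t \<in> A \<Longrightarrow> \<alpha> (norm (g t)) \<le> M"
  shows "bounded (g ` A)"
  unfolding bounded_iff using le_K_inv[OF assms(1) norm_ge_zero assms(2)] by blast

section \<open>Growth conditions and convergence of the rate integral at the origin\<close>

lemma order_S_bound:
  assumes "order_S x1 x2" "0 \<le> c"
  obtains B where "0 \<le> B" "\<And>s. 0 \<le> s \<Longrightarrow> x1 s / x2 c s \<le> B"
proof -
  obtain M where "\<And>s. 0 \<le> s \<Longrightarrow> x1 s / x2 c s \<le> M"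
    using assms unfolding order_S_def bdd_above_def by fastforce
  then show thesis using that[of "max 0 M"] by (simp add: le_max_iff_disj)
qed

text \<open>The only singularity of the integrand is at \<open>0\<close>; on \<open>{s..s'}\<close>
  it is continuous.\<close>

lemma integrable_on_rate:
  assumes dr: "K_inf dr" and s: "0 < s" "s \<le> s'"
    and int: "(\<lambda>\<tau>. dr \<tau> / \<tau>\<^sup>2) integrable_on {0..s}"
  shows "(\<lambda>\<tau>. dr \<tau> / \<tau>\<^sup>2) integrable_on {0..s'}"
proof -
  have "continuous_on {s..s'} (\<lambda>\<tau>. dr \<tau> / \<tau>\<^sup>2)"
    using s by (intro continuous_intros K_inf_continuous_on[OF dr]) auto
  then show ?thesis
    using s by (intro Henstock_Kurzweil_Integration.integrable_combine[OF _ _ int] integrable_continuous_real) auto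
qed

text \<open>If the integral diverged at \<open>0\<close>, then \<open>rho lo dr 1\<close> would be a positive constant on \<open>{s..}\<close>,
  and \<open>\<gamma>\<close> would be bounded.\<close>

lemma rate_integrable_at_0:
  assumes lo: "K_inf lo" and dr: "K_inf dr" and \<gamma>: "K_inf \<gamma>" and "0 < s"
    and le: "\<And>r. \<gamma> r \<le> g r"
    and ord: "order_S g (\<lambda>c s. 1 / rho lo dr c s)"
  shows "(\<lambda>\<tau>. dr \<tau> / \<tau>\<^sup>2) integrable_on {0..s}"
proof (rule ccontr)
  assume non: "\<not> (\<lambda>\<tau>. dr \<tau> / \<tau>\<^sup>2) integrable_on {0..s}"
  define k where "k = K_inv lo 1"
  have "0 < k" unfolding k_def by (rule K_inv_pos[OF lo]) simp
  obtain B where B: "\<And>r. 0 \<le> r \<Longrightarrow> g r / (1 / rho lo dr 1 r) \<le> B"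
    using order_S_bound[OF ord, of 1] by auto
  have bd: "\<gamma> r \<le> B / k" if "s \<le> r" for r
  proof -
    have "\<not> (\<lambda>\<tau>. dr \<tau> / \<tau>\<^sup>2) integrable_on {0..r}"
      using non integrable_on_subinterval[of _ "{0..r}" 0 s] that by auto
    \<comment> \<open>A non-integrable function has \<open>integral\<close> equal to
      \<open>0\<close> by convention, so the exponential factor in \<open>rho\<close> is 1.\<close>
    then have "rho lo dr 1 r = k"
      unfolding rho_def k_def by (simp add: not_integrable_integral)
    then have "g r * k \<le> B" using B[of r] that \<open>0 < s\<close> by simp
    moreover have "\<gamma> r * k \<le> g r * k" using le[of r] \<open>0 < k\<close> by (simp add: mult_right_mono)
    ultimately have "\<gamma> r * k \<le> B" by linarith
    then show ?thesis using \<open>0 < k\<close> by (simp add: pos_le_divide_eq)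
  qed
  \<comment> \<open>The point where \<open>\<gamma>\<close> exceeds the bound may lie to the left of
    \<open>s\<close>; monotonicity carries the excess over to \<open>max r s\<close>.\<close>
  obtain r where "r \<ge> 0" "B / k < \<gamma> r" using \<gamma> unfolding K_inf_def by blast
  then have "B / k < \<gamma> (max r s)" using K_inf_mono[OF \<gamma>, of r "max r s"] by simp
  with bd[of "max r s"] show False by simp
qed

section \<open>Real analysis\<close>

lemma has_vector_derivative_vec_lambda:
  fixes f :: "'i::finite \<Rightarrow> real \<Rightarrow> 'a::real_normed_vector"
  assumes "\<And>i. (f i has_vector_derivative f' i) (at t within X)"
  shows "((\<lambda>t. \<chi> i. f i t) has_vector_derivative (\<chi> i. f' i)) (at t within X)"
proof -
  have bl: "bounded_linear (\<lambda>h. h *\<^sub>R (\<chi> i. f' i))" by (rule bounded_linear_scaleR_left)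
  show ?thesis
    using assms unfolding has_vector_derivative_def has_derivative_within
    by (intro conjI bl vec_tendstoI) (simp add: bounded_linear_scaleR_left)
qed

text \<open>The integrating factor \<open>exp (A t)\<close> turns the differential inequality into
  monotonicity of \<open>(U t - K) * exp (A t)\<close>. The level \<open>K\<close> is
  \<open>0\<close> for the unforced inequality and absorbs the inputs in the forced one.\<close>

lemma gronwall_decay:
  fixes U A :: "real \<Rightarrow> real"
  assumes U: "\<And>t. t \<in> {a..<b} \<Longrightarrow> (U has_real_derivative U' t) (at t within {a..<b})"
    and A: "\<And>t. t \<in> {a..<b} \<Longrightarrow> (A has_real_derivative A' t) (at t within {a..<b})"
    and le: "\<And>t. t \<in> {a..<b} \<Longrightarrow> U' t \<le> - A' t * (U t - K)"
    and t: "t \<in> {a..<b}"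
  shows "U t - K \<le> (U a - K) * exp (A a - A t)"
proof -
  define g where "g = (\<lambda>t. (U t - K) * exp (A t))"
  have g: "(g has_real_derivative (U' t + A' t * (U t - K)) * exp (A t)) (at t within {a..<b})"
    if "t \<in> {a..<b}" for t
  proof -
    have "((\<lambda>t. U t - K) has_real_derivative U' t) (at t within {a..<b})"
      using DERIV_diff[OF U[OF that] DERIV_const[of K]] by simp
    from DERIV_mult[OF this DERIV_chain2[OF DERIV_exp A[OF that]]]
    show ?thesis unfolding g_def by (simp add: algebra_simps)
  qed
  have "g t \<le> g a"
  proof (rule DERIV_nonpos_imp_decreasing_open[of a t g])
    show "a \<le> t" using t by simp
    \<comment> \<open>At \<open>a\<close> the derivative is only one-sided, so monotonicity comes
      from two-sided derivatives at interior points together with continuity on the closed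
      interval.\<close>
    show "\<exists>y. (g has_real_derivative y) (at s) \<and> y \<le> 0" if s: "a < s" "s < t" for s
    proof -
      have "s \<in> interior {a..<b}" using s t by simp
      then have "(g has_real_derivative (U' s + A' s * (U s - K)) * exp (A s)) (at s)"
        using g[of s] s t at_within_interior[of s "{a..<b}"] by simp
      moreover have "U' s + A' s * (U s - K) \<le> 0"
        using le[of s] s t by simp
      then have "(U' s + A' s * (U s - K)) * exp (A s) \<le> 0"
        by (rule mult_nonpos_nonneg) simp
      ultimately show ?thesis by blast
    qed
    have "continuous_on {a..<b} g"
      by (rule DERIV_continuous_on[OF g])
    then show "continuous_on {a..t} g" by (rule continuous_on_subset) (use t in auto)
  qed
  then show ?thesis unfolding g_def exp_diff by (simp add: pos_le_divide_eq)
qed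

text \<open>Near \<open>b\<close> the function stays in a unit ball around its limit; what remains
  is the continuous image of a compact interval.\<close>

lemma bounded_if_left_limit:
  fixes f :: "real \<Rightarrow> 'a::real_normed_vector"
  assumes cont: "continuous_on {a..<b} f" and lim: "(f \<longlongrightarrow> l) (at_left b)"
  shows "bounded (f ` {a..<b})"
proof -
  have "\<forall>\<^sub>F t in at_left b. dist (f t) l < 1" using lim by (rule tendstoD) simp
  then obtain c where c: "c < b" "\<And>t. c < t \<Longrightarrow> t < b \<Longrightarrow> dist (f t) l < 1"
    unfolding eventually_at_left_field by blast
  have "continuous_on {a..c} f" by (rule continuous_on_subset[OF cont]) (use c(1) in auto)
  then have "bounded (f ` {a..c})"
    using compact_continuous_image compact_imp_bounded compact_Icc by blast
  moreover have "bounded (f ` {c<..<b})"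
    by (rule bounded_subset[OF bounded_ball[of l 1]]) (use c(2) in \<open>force simp: dist_commute\<close>)
  ultimately have "bounded (f ` {a..c} \<union> f ` {c<..<b})" by simp
  moreover have "f ` {a..<b} \<subseteq> f ` {a..c} \<union> f ` {c<..<b}" by (force simp flip: image_Un)
  ultimately show ?thesis by (rule bounded_subset)
qed

lemma Ck_on_1_chain:
  assumes "Ck_on 1 V UNIV" "(f has_vector_derivative f') (at t within X)"
  shows "((\<lambda>t. V (f t)) has_vector_derivative frechet_derivative V (at (f t)) f') (at t within X)"
proof -
  have "(V has_derivative frechet_derivative V (at (f t))) (at (f t) within f ` X)"
    using assms(1) by (simp add: frechet_derivative_works has_derivative_at_withinI)
  from vector_derivative_diff_chain_within[OF assms(2) this] show ?thesis by (simp add: o_def)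
qed

section \<open>The gain\<close>

lemma gain_props:
  assumes "0 < horizon S" "t \<in> time_dom S"
  shows "gain S t \<in> gain_range S" "0 < gain S t" "1 / horizon S \<le> gain S t"
    "(gain S has_real_derivative (gain S t)\<^sup>2) (at t within X)"
proof -
  have *: "0 < horizon S + init_time S - t" "horizon S + init_time S - t \<le> horizon S"
    using assms unfolding time_dom_def by auto
  show "0 < gain S t" "1 / horizon S \<le> gain S t"
    using * by (auto simp: gain_def intro: divide_left_mono)
  then show "gain S t \<in> gain_range S" by (simp add: gain_range_def)
  show "(gain S has_real_derivative (gain S t)\<^sup>2) (at t within X)"
    unfolding gain_def using *
    by (auto intro!: derivative_eq_intros simp: power2_eq_square)
qed

lemma gain_init: "gain S (init_time S) = 1 / horizon S"
  by (simp add: gain_def)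

lemma gain_at_top: "filterlim (gain S) at_top (at_left (horizon S + init_time S))"
proof -
  let ?b = "horizon S + init_time S"
  have "((\<lambda>t. ?b - t) \<longlongrightarrow> ?b - ?b) (at_left ?b)" by (intro tendsto_intros)
  moreover have "\<forall>\<^sub>F t in at_left ?b. 0 < ?b - t"
    unfolding eventually_at_left_field by (intro exI[of _ "?b - 1"]) auto
  ultimately have "filterlim (\<lambda>t. ?b - t) (at_right 0) (at_left ?b)"
    by (auto intro: tendsto_imp_filterlim_at_right)
  then have "filterlim (\<lambda>t. inverse (?b - t)) at_top (at_left ?b)"
    by (rule filterlim_compose[OF filterlim_inverse_at_top_right])
  then show ?thesis unfolding gain_def[abs_def] by (simp add: inverse_eq_divide)
qed

lemma eventually_time_dom:
  assumes "0 < horizon S"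
  shows "\<forall>\<^sub>F t in at_left (horizon S + init_time S). t \<in> time_dom S"
  unfolding eventually_at_left_field time_dom_def
  using assms by (intro exI[of _ "init_time S"]) auto

text \<open>The substitution \<open>\<mu> = gain S t\<close>, in differential form: the derivative is
  \<open>dr \<mu> / \<mu>\<^sup>2 * \<mu>'\<close>.\<close>

lemma rate_integral_derivative:
  assumes S: "0 < horizon S" and dr: "K_inf dr" and t: "t \<in> time_dom S"
  shows "((\<lambda>t. integral {1 / horizon S..gain S t} (\<lambda>\<tau>. dr \<tau> / \<tau>\<^sup>2)) has_real_derivative dr (gain S t))
           (at t within time_dom S)"
proof -
  \<comment> \<open>Integrating from the initial gain instead of \<open>0\<close> avoids the
    singularity. The missing piece over \<open>{0..a}\<close> is a constant, which
    \<open>lyapunov_decay_rho\<close> puts into \<open>c\<close>.\<close>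
  define a where "a = 1 / horizon S"
  have "0 < a" using S by (simp add: a_def)
  define I where "I = (\<lambda>s. integral {a..s} (\<lambda>\<tau>. dr \<tau> / \<tau>\<^sup>2))"
  let ?\<mu> = "gain S t"
  have "continuous_on {a..?\<mu> + 1} (\<lambda>\<tau>. dr \<tau> / \<tau>\<^sup>2)"
    using \<open>0 < a\<close> by (intro continuous_intros K_inf_continuous_on[OF dr]) auto
  then have "(I has_real_derivative dr ?\<mu> / ?\<mu>\<^sup>2) (at ?\<mu> within {a..?\<mu> + 1})"
    unfolding I_def using gain_props[OF S t]
    by (intro integral_has_real_derivative) (auto simp: a_def)
  \<comment> \<open>The end \<open>?\<mu> + 1\<close> is an arbitrary point beyond
    \<open>?\<mu>\<close>: a derivative depends only on a neighbourhood, so the compact interval of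
    the fundamental theorem may be exchanged for the half line that contains all gains.\<close>
  moreover have "at ?\<mu> within {a..} = at ?\<mu> within {a..?\<mu> + 1}"
    by (rule at_within_nhd[of _ "{..<?\<mu> + 1}"]) auto
  ultimately have "(I has_real_derivative dr ?\<mu> / ?\<mu>\<^sup>2) (at ?\<mu> within {a..})" by simp
  then have "(I has_real_derivative dr ?\<mu> / ?\<mu>\<^sup>2) (at ?\<mu> within gain S ` time_dom S)"
    by (rule has_field_derivative_subset) (auto simp: a_def intro: gain_props(3)[OF S])
  from DERIV_image_chain[OF this gain_props(4)[OF S t]]
  show ?thesis
    unfolding I_def a_def using gain_props(2)[OF S t] by (simp add: o_def)
qed

section \<open>The error system along a trajectory\<close>

text \<open>This and the next two identities show that the fields written in error coordinates are
  the original closed loop when evaluated along a trajectory.\<close>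

lemma zeta_of_er_sig: "zeta_of S (er_sig S w p t) = zeta_sig w p t"
  by (rule ext) (simp add: zeta_of_def er_sig_def zeta_eq_def zeta_sig_def)

lemma xi_of_sig: "xi_of S (es_sig x y v w i t) (er_sig S w p t) i = (x i t, y i t)"
  by (simp add: xi_of_def zeta_of_er_sig es_sig_def zeta_sig_def)

lemma u_of_sig: "u_of S i (es_sig x y v w i t) (er_sig S w p t) (gain S t) = input_sig S x y v w p i t"
  by (simp add: u_of_def xi_of_sig zeta_of_er_sig input_sig_def) (simp add: es_sig_def)

lemma zeta_sig_derivatives:
  assumes tr: "trajectory S x y v w p" and t: "t \<in> time_dom S"
  defines "F \<equiv> \<lambda>i. ctr_zeta S i (zeta_sig w p t i) (coupling S (zeta_sig w p t) i) (gain S t)"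
  shows "(w i has_vector_derivative fst (F i)) (at t within time_dom S)"
    and "(p i has_vector_derivative snd (F i)) (at t within time_dom S)"
proof -
  have z: "((\<lambda>t. (w i t, p i t)) has_vector_derivative F i) (at t within time_dom S)"
    using tr t unfolding trajectory_def F_def by (simp add: zeta_sig_def)
  show "(w i has_vector_derivative fst (F i)) (at t within time_dom S)"
    using bounded_linear.has_vector_derivative[OF bounded_linear_fst z] by simp
  show "(p i has_vector_derivative snd (F i)) (at t within time_dom S)"
    using bounded_linear.has_vector_derivative[OF bounded_linear_snd z] by simp
qed

lemma er_sig_derivative:
  assumes tr: "trajectory S x y v w p" and t: "t \<in> time_dom S"
  shows "(er_sig S w p has_vector_derivative err_r S (er_sig S w p t) (gain S t))
           (at t within time_dom S)"
proof -
  have "((\<lambda>t. (\<chi> i. w i t - zstar S, \<chi> i. p i t - p_eq S i (zstar S))) has_vector_derivative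
      err_r S (er_sig S w p t) (gain S t)) (at t within time_dom S)"
    unfolding err_r_def Let_def zeta_of_er_sig
    by (intro has_vector_derivative_Pair has_vector_derivative_vec_lambda)
      (simp_all add: has_vector_derivative_diff_const zeta_sig_derivatives[OF tr t])
  then show ?thesis by (simp add: er_sig_def[abs_def])
qed

lemma es_sig_derivative:
  assumes tr: "trajectory S x y v w p" and t: "t \<in> time_dom S"
  shows "(es_sig x y v w i has_vector_derivative
           err_s S i (es_sig x y v w i t) (er_sig S w p t) (disturb S i t) (gain S t))
           (at t within time_dom S)"
proof -
  let ?u = "input_sig S x y v w p i t"
  have "err_s S i (es_sig x y v w i t) (er_sig S w p t) (disturb S i t) (gain S t)
      = (dyn_x S i (x i t) (y i t) ?u (disturb S i t),
         dyn_y S i (x i t) (y i t) ?u (disturb S i t)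
           - fst (ctr_zeta S i (zeta_sig w p t i) (coupling S (zeta_sig w p t) i) (gain S t)),
         ctr_vs S i (v i t) (zeta_sig w p t i) (x i t, y i t) (gain S t))"
    by (simp add: err_s_def Let_def u_of_sig xi_of_sig vs_of_def zeta_of_er_sig err_r_def)
      (simp add: es_sig_def)
  moreover have "((\<lambda>t. (x i t, y i t - w i t, v i t)) has_vector_derivative \<dots>)
      (at t within time_dom S)"
    by (rule has_vector_derivative_Pair has_vector_derivative_diff zeta_sig_derivatives[OF tr t]
        tr[unfolded trajectory_def, rule_format, OF t, THEN conjunct1]
        tr[unfolded trajectory_def, rule_format, OF t, THEN conjunct2, THEN conjunct1]
        tr[unfolded trajectory_def, rule_format, OF t, THEN conjunct2, THEN conjunct2,
          THEN conjunct1])+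
  ultimately show ?thesis by (simp add: es_sig_def[abs_def])
qed

text \<open>Chain rule for \<open>trans_s\<close> along the curve of pairs
  \<open>(es, \<mu>)\<close>, whose velocity has second component
  \<open>\<mu>\<^sup>2\<close>.\<close>

lemma est_sig_derivative:
  assumes tr: "trajectory S x y v w p" and t: "t \<in> time_dom S"
    and S: "0 < horizon S" and d: "disturb S i t \<in> dist_set S"
    and transf: "transformed_system S Fs Hv Hu"
  shows "(est_sig S x y v w i has_vector_derivative
           Fs i (est_sig S x y v w i t) (er_sig S w p t) (disturb S i t) (gain S t))
           (at t within time_dom S)"
proof -
  let ?es = "es_sig x y v w i" and ?er = "er_sig S w p t" and ?\<mu> = "gain S t"
  obtain D where
    D: "((\<lambda>(e, m). trans_s S i e m) has_derivative D) (at (?es t, ?\<mu>) within UNIV \<times> gain_range S)"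
    and F: "Fs i (trans_s S i (?es t) ?\<mu>) ?er (disturb S i t) ?\<mu>
              = D (err_s S i (?es t) ?er (disturb S i t) ?\<mu>, ?\<mu>\<^sup>2)"
    using transf gain_props(1)[OF S t] d unfolding transformed_system_def by meson
  have "(gain S has_vector_derivative ?\<mu>\<^sup>2) (at t within time_dom S)"
    using gain_props(4)[OF S t] by (simp add: has_real_derivative_iff_has_vector_derivative)
  then have "((\<lambda>t. (?es t, gain S t)) has_vector_derivative
      (err_s S i (?es t) ?er (disturb S i t) ?\<mu>, ?\<mu>\<^sup>2)) (at t within time_dom S)"
    by (intro has_vector_derivative_Pair es_sig_derivative[OF tr t])
  \<comment> \<open>\<open>D\<close> is a derivative relative to
    \<open>UNIV \<times> gain_range S\<close> only, one-sided at the initial gain; this suffices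
    because the curve never leaves that set.\<close>
  moreover have "((\<lambda>(e, m). trans_s S i e m) has_derivative D)
      (at (?es t, ?\<mu>) within (\<lambda>t. (?es t, gain S t)) ` time_dom S)"
    using gain_props(1)[OF S] by (intro has_derivative_subset[OF D]) auto
  ultimately have "((\<lambda>(e, m). trans_s S i e m) \<circ> (\<lambda>t. (?es t, gain S t)) has_vector_derivative
      D (err_s S i (?es t) ?er (disturb S i t) ?\<mu>, ?\<mu>\<^sup>2)) (at t within time_dom S)"
    by (rule vector_derivative_diff_chain_within)
  then show ?thesis using F by (simp add: o_def est_sig_def[abs_def])
qed

section \<open>Integrated Lyapunov inequalities along solutions\<close>

lemma lyapunov_decay_rho:
  assumes S: "0 < horizon S" and V: "lyapunov (gain_range S) V lo hi dr F"
    and int: "(\<lambda>\<tau>. dr \<tau> / \<tau>\<^sup>2) integrable_on {0..1 / horizon S}"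
    and e: "\<And>t. t \<in> time_dom S \<Longrightarrow>
      (e has_vector_derivative F (e t) (gain S t)) (at t within time_dom S)"
  obtains c where "0 < c" "\<And>t. t \<in> time_dom S \<Longrightarrow> norm (e t) \<le> rho lo dr c (gain S t)"
proof -
  define a where "a = 1 / horizon S"
  have "0 < a" using S by (simp add: a_def)
  have lb: "Ck_on 1 V UNIV" "K_inf lo" "K_inf dr" "\<And>x. lo (norm x) \<le> V x"
    using V by (auto simp: lyapunov_def lyapunov_bounds_def)
  define f where "f = (\<lambda>\<tau>. dr \<tau> / \<tau>\<^sup>2)"
  define W where "W = V (e (init_time S))"
  \<comment> \<open>The summand 1 keeps \<open>c\<close> positive even when the initial error
    vanishes. The exponential compensates for starting the integral at \<open>a\<close>, whereas
    \<open>rho\<close> integrates from \<open>0\<close>.\<close>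
  define c where "c = (W + 1) * exp (integral {0..a} f)"
  have "0 \<le> W" unfolding W_def using lb(4) K_inf_nonneg[OF lb(2) norm_ge_zero] order_trans by blast
  then have "0 < c" by (simp add: c_def)
  moreover have "norm (e t) \<le> rho lo dr c (gain S t)" if t: "t \<in> time_dom S" for t
  proof -
    have "V (e t) - 0 \<le> (V (e (init_time S)) - 0)
        * exp (integral {a..gain S (init_time S)} f - integral {a..gain S t} f)"
    proof (rule gronwall_decay)
      show "t \<in> {init_time S..<horizon S + init_time S}" using t by (simp add: time_dom_def)
      fix s assume "s \<in> {init_time S..<horizon S + init_time S}"
      then have s: "s \<in> time_dom S" by (simp add: time_dom_def)
      show "((\<lambda>t. V (e t)) has_real_derivative
          frechet_derivative V (at (e s)) (F (e s) (gain S s)))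
          (at s within {init_time S..<horizon S + init_time S})"
        using Ck_on_1_chain[OF lb(1) e[OF s]]
        by (simp add: has_real_derivative_iff_has_vector_derivative time_dom_def)
      show "((\<lambda>t. integral {a..gain S t} f) has_real_derivative dr (gain S s))
          (at s within {init_time S..<horizon S + init_time S})"
        using rate_integral_derivative[OF S lb(3) s] by (simp add: time_dom_def a_def f_def)
      show "frechet_derivative V (at (e s)) (F (e s) (gain S s)) \<le> - dr (gain S s) * (V (e s) - 0)"
        using V gain_props(1)[OF S s] by (simp add: lyapunov_def)
    qed
    also have "\<dots> = W * exp (- integral {a..gain S t} f)"
      by (simp add: W_def gain_init a_def)
    also have "\<dots> \<le> (W + 1) * exp (- integral {a..gain S t} f)" by simp
    also have "\<dots> = c * exp (- integral {0..gain S t} f)"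
    proof -
      have ga: "a \<le> gain S t" using gain_props(3)[OF S t] by (simp add: a_def)
      have "f integrable_on {0..gain S t}"
        using integrable_on_rate[OF lb(3) \<open>0 < a\<close> ga] int by (simp add: f_def a_def)
      then have "integral {0..a} f + integral {a..gain S t} f = integral {0..gain S t} f"
        using ga \<open>0 < a\<close> by (intro Henstock_Kurzweil_Integration.integral_combine) auto
      then show ?thesis by (simp add: c_def mult.assoc flip: exp_add)
    qed
    finally have "V (e t) \<le> c * exp (- integral {0..gain S t} f)" by simp
    then have "lo (norm (e t)) \<le> c * exp (- integral {0..gain S t} f)"
      using lb(4) order_trans by blast
    then show ?thesis unfolding rho_def f_def by (intro le_K_inv[OF lb(2)]) auto
  qed
  ultimately show thesis using that by blast
qed

text \<open>By \<open>K\<close> the forced inequality becomes decay of \<open>V - K\<close> at rate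
  \<open>dr\<close>, so \<open>V\<close> stays below a constant and the lower bound
  \<open>lo\<close> transfers this to the norm.\<close>

lemma lyapunov_inputs_bounded:
  assumes S: "0 < horizon S"
    and V: "lyapunov_inputs (gain_range S) D V lo hi dr \<sigma>1 \<sigma>t1 \<sigma>2 \<sigma>t2 F"
    and K: "\<And>t. t \<in> time_dom S \<Longrightarrow>
      \<sigma>t1 (gain S t) * \<sigma>1 (norm (r t)) + \<sigma>t2 (gain S t) * \<sigma>2 (norm (d t)) \<le> dr (gain S t) * K"
    and d: "\<And>t. t \<in> time_dom S \<Longrightarrow> d t \<in> D"
    and e: "\<And>t. t \<in> time_dom S \<Longrightarrow>
      (e has_vector_derivative F (e t) (r t) (d t) (gain S t)) (at t within time_dom S)"
  shows "bounded (e ` time_dom S)"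
proof -
  define a where "a = 1 / horizon S"
  define I where "I = (\<lambda>t. integral {a..gain S t} (\<lambda>\<tau>. dr \<tau> / \<tau>\<^sup>2))"
  have lb: "Ck_on 1 V UNIV" "K_inf lo" "K_inf dr" "\<And>x. lo (norm x) \<le> V x"
    using V by (auto simp: lyapunov_inputs_def lyapunov_bounds_def)
  let ?V0 = "V (e (init_time S))"
  have "lo (norm (e t)) \<le> K + \<bar>?V0 - K\<bar>" if t: "t \<in> time_dom S" for t
  proof -
    have "V (e t) - K \<le> (?V0 - K) * exp (I (init_time S) - I t)"
    proof (rule gronwall_decay)
      show "t \<in> {init_time S..<horizon S + init_time S}" using t by (simp add: time_dom_def)
      fix s assume "s \<in> {init_time S..<horizon S + init_time S}"
      then have s: "s \<in> time_dom S" by (simp add: time_dom_def)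
      show "((\<lambda>t. V (e t)) has_real_derivative
          frechet_derivative V (at (e s)) (F (e s) (r s) (d s) (gain S s)))
          (at s within {init_time S..<horizon S + init_time S})"
        using Ck_on_1_chain[OF lb(1) e[OF s]]
        by (simp add: has_real_derivative_iff_has_vector_derivative time_dom_def)
      show "(I has_real_derivative dr (gain S s))
          (at s within {init_time S..<horizon S + init_time S})"
        using rate_integral_derivative[OF S lb(3) s] by (simp add: time_dom_def a_def I_def)
      have "frechet_derivative V (at (e s)) (F (e s) (r s) (d s) (gain S s))
          \<le> - dr (gain S s) * V (e s) + \<sigma>t1 (gain S s) * \<sigma>1 (norm (r s))
             + \<sigma>t2 (gain S s) * \<sigma>2 (norm (d s))"
        using V gain_props(1)[OF S s] d[OF s] by (simp add: lyapunov_inputs_def)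
      with K[OF s] show "frechet_derivative V (at (e s)) (F (e s) (r s) (d s) (gain S s))
          \<le> - dr (gain S s) * (V (e s) - K)"
        by (simp add: algebra_simps)
    qed
    \<comment> \<open>\<open>V\<close> may start on either side of the level \<open>K\<close>; the
      absolute value covers both cases, and the exponent is at most \<open>0\<close>.\<close>
    also have "\<dots> \<le> \<bar>?V0 - K\<bar> * 1"
    proof -
      have "I (init_time S) = 0" by (simp add: I_def gain_init a_def)
      moreover have "0 \<le> I t"
        unfolding I_def
      \<comment> \<open>Without integrability the integral is \<open>0\<close> by convention, so
        nonnegativity holds in either case.\<close>
      proof (cases "(\<lambda>\<tau>. dr \<tau> / \<tau>\<^sup>2) integrable_on {a..gain S t}")
        case True
        moreover have "0 \<le> dr \<tau> / \<tau>\<^sup>2" if "\<tau> \<in> {a..gain S t}" for \<tau>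
          using that S K_inf_nonneg[OF lb(3), of \<tau>]
            order_trans[of 0 a \<tau>] by (simp add: a_def)
        ultimately show "0 \<le> integral {a..gain S t} (\<lambda>\<tau>. dr \<tau> / \<tau>\<^sup>2)"
          by (rule Henstock_Kurzweil_Integration.integral_nonneg)
      qed (simp add: not_integrable_integral)
      ultimately show ?thesis by (intro mult_mono) auto
    qed
    finally show ?thesis using lb(4)[of "e t"] by simp
  qed
  then show ?thesis by (rule bounded_if_K_inf_bounded[OF lb(2)])
qed

section \<open>Prescribed-time convergence\<close>

text \<open>Since \<open>\<gamma> (gain S t)\<close> tends to infinity at the prescribed time, the
  bound \<open>B / \<gamma> (gain S t)\<close> on the norm tends to \<open>0\<close>.\<close>

lemma tendsto_0_if_gain_times_bounded:
  assumes S: "0 < horizon S" and \<gamma>: "K_inf \<gamma>"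
    and bd: "\<And>t. t \<in> time_dom S \<Longrightarrow> \<gamma> (gain S t) * norm (e t) \<le> B"
  shows "(e \<longlongrightarrow> 0) (at_left (horizon S + init_time S))"
proof (rule Lim_null_comparison)
  let ?F = "at_left (horizon S + init_time S)"
  have "filterlim (\<lambda>t. \<gamma> (gain S t)) at_top ?F"
    by (rule filterlim_compose[OF K_inf_at_top[OF \<gamma>] gain_at_top])
  then show "((\<lambda>t. B / \<gamma> (gain S t)) \<longlongrightarrow> 0) ?F"
    by (intro tendsto_divide_0[OF tendsto_const] filterlim_at_top_imp_at_infinity)
  show "\<forall>\<^sub>F t in ?F. norm (e t) \<le> B / \<gamma> (gain S t)"
    using eventually_time_dom[OF S]
  proof eventually_elim
    case (elim t)
    then show ?case
      using bd[OF elim] K_inf_pos[OF \<gamma> gain_props(2)[OF S elim]]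
      by (simp add: pos_le_divide_eq mult.commute)
  qed
qed

text \<open>Supplies the constant \<open>K\<close> for \<open>lyapunov_inputs_bounded\<close>: each
  growth condition dominates one input term by a multiple of \<open>dr\<close>, where the first
  input is replaced by its decay bound and the second by the size of \<open>D\<close>.\<close>

lemma input_terms_absorbed:
  assumes S: "0 < horizon S"
    and V: "lyapunov_inputs (gain_range S) D V lo hi dr \<sigma>1 \<sigma>t1 \<sigma>2 \<sigma>t2 F"
    and \<sigma>1: "K_inf \<sigma>1" and lo_r: "K_inf lo_r" and c: "0 < c" and D: "bounded D"
    and growth_d: "order_S \<sigma>t2 (\<lambda>c s. exp c * dr s)"
    and growth_r: "order_S \<sigma>t1 (\<lambda>c s. dr s / \<sigma>1 (rho lo_r dr_r c s))"
    and r: "\<And>t. t \<in> time_dom S \<Longrightarrow> norm (r t) \<le> rho lo_r dr_r c (gain S t)"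
    and d: "\<And>t. t \<in> time_dom S \<Longrightarrow> d t \<in> D"
  obtains K where "\<And>t. t \<in> time_dom S \<Longrightarrow>
    \<sigma>t1 (gain S t) * \<sigma>1 (norm (r t)) + \<sigma>t2 (gain S t) * \<sigma>2 (norm (d t)) \<le> dr (gain S t) * K"
proof -
  have K: "K_inf dr" "K_inf \<sigma>t1" "K_inf_e \<sigma>2" "K_inf \<sigma>t2"
    using V by (auto simp: lyapunov_inputs_def lyapunov_bounds_def)
  obtain B1 where B1: "0 \<le> B1"
    "\<And>s. 0 \<le> s \<Longrightarrow> \<sigma>t1 s / (dr s / \<sigma>1 (rho lo_r dr_r c s)) \<le> B1"
    by (rule order_S_bound[OF growth_r, of c]) (use c in auto)
  \<comment> \<open>The parameter \<open>0\<close> makes the factor \<open>exp c\<close> equal to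
    1.\<close>
  obtain B2 where B2: "0 \<le> B2" "\<And>s. 0 \<le> s \<Longrightarrow> \<sigma>t2 s / (exp 0 * dr s) \<le> B2"
    by (rule order_S_bound[OF growth_d, of 0]) auto
  obtain M where M: "\<And>x. x \<in> D \<Longrightarrow> norm x \<le> M"
    using D unfolding bounded_iff by blast
  have "\<sigma>t1 (gain S t) * \<sigma>1 (norm (r t)) + \<sigma>t2 (gain S t) * \<sigma>2 (norm (d t))
      \<le> dr (gain S t) * (B1 + B2 * \<sigma>2 M)" if t: "t \<in> time_dom S" for t
  proof -
    let ?\<mu> = "gain S t"
    have \<mu>: "0 < ?\<mu>" by (rule gain_props(2)[OF S t])
    have dr: "0 < dr ?\<mu>" by (rule K_inf_pos[OF K(1) \<mu>])
    have \<sigma>\<rho>: "0 < \<sigma>1 (rho lo_r dr_r c ?\<mu>)"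
      by (rule K_inf_pos[OF \<sigma>1 rho_pos[OF lo_r c]])
    have \<sigma>t: "0 \<le> \<sigma>t1 ?\<mu>" "0 \<le> \<sigma>t2 ?\<mu>"
      using K_inf_nonneg[OF K(2)] K_inf_nonneg[OF K(4)] \<mu> by auto
    have "\<sigma>t1 ?\<mu> * \<sigma>1 (norm (r t)) \<le> \<sigma>t1 ?\<mu> * \<sigma>1 (rho lo_r dr_r c ?\<mu>)"
      by (rule mult_left_mono[OF K_inf_mono[OF \<sigma>1 norm_ge_zero r[OF t]] \<sigma>t(1)])
    also have "\<dots> \<le> dr ?\<mu> * B1"
      using B1(2)[of ?\<mu>] \<mu> dr \<sigma>\<rho> by (simp add: pos_divide_le_eq mult.commute)
    finally have 1: "\<sigma>t1 ?\<mu> * \<sigma>1 (norm (r t)) \<le> dr ?\<mu> * B1" .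
    have m: "norm (d t) \<le> M" by (rule M[OF d[OF t]])
    \<comment> \<open>The sign of \<open>M\<close> is read off from the point \<open>d t\<close> of
      \<open>D\<close>.\<close>
    then have "0 \<le> M" using norm_ge_zero order_trans by blast
    then have "0 \<le> \<sigma>2 M"
      using K_inf_e_mono[OF K(3), of 0 M] K(3) by (simp add: K_inf_e_def)
    \<comment> \<open>\<open>\<sigma>2\<close> may be discontinuous, so its bound over
      \<open>D\<close> comes from monotonicity and the norm bound \<open>M\<close>, not from
      compactness.\<close>
    have "\<sigma>t2 ?\<mu> * \<sigma>2 (norm (d t)) \<le> \<sigma>t2 ?\<mu> * \<sigma>2 M"
      by (rule mult_left_mono[OF K_inf_e_mono[OF K(3) norm_ge_zero m] \<sigma>t(2)])
    also have "\<dots> \<le> (B2 * dr ?\<mu>) * \<sigma>2 M"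
      using B2(2)[of ?\<mu>] \<mu> dr
      by (intro mult_right_mono[OF _ \<open>0 \<le> \<sigma>2 M\<close>]) (simp add: pos_divide_le_eq)
    finally show ?thesis using 1 by (simp add: algebra_simps)
  qed
  then show thesis by (rule that)
qed

theorem mainTheorem2:
  fixes S :: "('v::finite, 'n::finite, 'm::finite, 'q::finite, 'd::finite, 'k::finite, 'p::finite, 's::finite) mas"
    and Fs :: "'v \<Rightarrow> real^'s \<Rightarrow> ((real^'m)^'v) \<times> ((real^'p)^'v) \<Rightarrow> real^'d \<Rightarrow> real \<Rightarrow> real^'s"
    and Hv :: "'v \<Rightarrow> real^'s \<Rightarrow> ((real^'m)^'v) \<times> ((real^'p)^'v) \<Rightarrow> real \<Rightarrow> real^'k"
    and Hu :: "'v \<Rightarrow> real^'s \<Rightarrow> ((real^'m)^'v) \<times> ((real^'p)^'v) \<Rightarrow> real \<Rightarrow> real^'q"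
    and lo_r hi_r dr_r \<gamma>\<zeta> :: "real \<Rightarrow> real"
    and lo_s hi_s dr_s \<sigma>r \<sigma>tr \<sigma>d \<sigma>td \<gamma>s \<gamma>ts \<gamma>v \<gamma>u :: "'v \<Rightarrow> real \<Rightarrow> real"
  assumes standing: "standing S"
    and transf: "transformed_system S Fs Hv Hu"
    and C1: "cond_C1 S lo_r hi_r dr_r \<gamma>\<zeta>"
    and C2: "cond_C2' S Fs lo_s hi_s dr_s \<sigma>r \<sigma>tr \<sigma>d \<sigma>td"
    and C3: "cond_C3' S Hv Hu \<gamma>s \<gamma>ts \<gamma>v \<gamma>u"
    and growth_\<gamma>: "\<And>i. order_S (\<lambda>s. Max {\<gamma>\<zeta> s, \<gamma>v i s, \<gamma>u i s}) (\<lambda>c s. 1 / rho lo_r dr_r c s)"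
    and growth_d: "\<And>i. order_S (\<sigma>td i) (\<lambda>c s. exp c * dr_s i s)"
    and growth_r: "\<And>i. order_S (\<sigma>tr i) (\<lambda>c s. dr_s i s / \<sigma>r i (rho lo_r dr_r c s))"
  shows "dptco_solved S"
  unfolding dptco_solved_def
proof (intro allI impI)
  fix x y v w p i
  assume tr: "trajectory S x y v w p"
  let ?b = "horizon S + init_time S"
  let ?er = "er_sig S w p" and ?est = "est_sig S x y v w i"
  have S: "0 < horizon S" and D: "bounded (dist_set S)"
    using standing by (auto simp: standing_def agents_ok_def compact_imp_bounded)
  have d: "disturb S i t \<in> dist_set S" if "t \<in> time_dom S" for t
    using standing that by (simp add: standing_def agents_ok_def time_dom_def)
  obtain Vr where Vr: "lyapunov (gain_range S) Vr lo_r hi_r dr_r (err_r S)"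
    and \<gamma>\<zeta>: "K_inf \<gamma>\<zeta>"
    using C1 unfolding cond_C1_def by blast
  have lo_r: "K_inf lo_r" and dr_r: "K_inf dr_r"
    using Vr by (auto simp: lyapunov_def lyapunov_bounds_def)
  \<comment> \<open>\<open>\<gamma>\<zeta>\<close> lies below the maximum, so the growth condition
    of the single agent \<open>i\<close> already forces convergence of the integral at
    \<open>0\<close>.\<close>
  have "(\<lambda>\<tau>. dr_r \<tau> / \<tau>\<^sup>2) integrable_on {0..1 / horizon S}"
    by (rule rate_integrable_at_0[OF lo_r dr_r \<gamma>\<zeta> _ _ growth_\<gamma>[of i]]) (use S in auto)
  then obtain c where c: "0 < c"
    and er: "\<And>t. t \<in> time_dom S \<Longrightarrow> norm (?er t) \<le> rho lo_r dr_r c (gain S t)"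
    using lyapunov_decay_rho[OF S Vr _ er_sig_derivative[OF tr]] by blast

  \<comment> \<open>One constant for the maximum serves two purposes: with
    \<open>\<gamma>\<zeta>\<close> it yields convergence of the stacked error, with
    \<open>\<gamma>u i\<close> the bound on the input.\<close>
  obtain B where B: "\<And>s. 0 \<le> s \<Longrightarrow>
      Max {\<gamma>\<zeta> s, \<gamma>v i s, \<gamma>u i s} / (1 / rho lo_r dr_r c s) \<le> B"
    using order_S_bound[OF growth_\<gamma>[of i], of c] c by auto
  have gain_er: "\<gamma> (gain S t) * norm (?er t) \<le> B"
    if t: "t \<in> time_dom S" and \<gamma>: "K_inf \<gamma>" "\<And>s. \<gamma> s \<le> Max {\<gamma>\<zeta> s, \<gamma>v i s, \<gamma>u i s}" for \<gamma> t
  proof -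
    have \<mu>: "0 \<le> gain S t" using gain_props(2)[OF S t] by simp
    have "\<gamma> (gain S t) * norm (?er t) \<le> \<gamma> (gain S t) * rho lo_r dr_r c (gain S t)"
      by (rule mult_left_mono[OF er[OF t] K_inf_nonneg[OF \<gamma>(1) \<mu>]])
    also have "\<dots> \<le> Max {\<gamma>\<zeta> (gain S t), \<gamma>v i (gain S t), \<gamma>u i (gain S t)}
        * rho lo_r dr_r c (gain S t)"
      by (rule mult_right_mono[OF \<gamma>(2)]) (simp add: less_imp_le rho_pos[OF lo_r c])
    also have "\<dots> \<le> B" using B[OF \<mu>] by simp
    finally show ?thesis .
  qed
  have er_0: "(?er \<longlongrightarrow> 0) (at_left ?b)"
    by (rule tendsto_0_if_gain_times_bounded[OF S \<gamma>\<zeta>]) (rule gain_er[OF _ \<gamma>\<zeta>], auto)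

  obtain Vs where Vs: "lyapunov_inputs (gain_range S) (dist_set S) Vs (lo_s i) (hi_s i) (dr_s i)
      (\<sigma>r i) (\<sigma>tr i) (\<sigma>d i) (\<sigma>td i) (Fs i)" and \<sigma>r: "K_inf (\<sigma>r i)"
    using C2 unfolding cond_C2'_def by blast
  obtain K where K: "\<And>t. t \<in> time_dom S \<Longrightarrow>
      \<sigma>tr i (gain S t) * \<sigma>r i (norm (?er t)) + \<sigma>td i (gain S t) * \<sigma>d i (norm (disturb S i t))
        \<le> dr_s i (gain S t) * K"
    using input_terms_absorbed[where r = ?er and d = "disturb S i",
        OF S Vs \<sigma>r lo_r c D growth_d growth_r er d] by blast
  have est: "bounded (?est ` time_dom S)"
    by (rule lyapunov_inputs_bounded[OF S Vs K d est_sig_derivative[OF tr _ S d transf]])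

  \<comment> \<open>The transformed error is merely bounded; convergence of the original error is
    the final clause of \<open>cond_C2'\<close>.\<close>
  have es_0: "(es_sig x y v w i \<longlongrightarrow> 0) (at_left ?b)"
    using C2 tr est unfolding cond_C2'_def by blast
  have x_0: "(x i \<longlongrightarrow> 0) (at_left ?b)"
    using tendsto_fst[OF es_0] by (simp add: es_sig_def)
  have yw_0: "((\<lambda>t. y i t - w i t) \<longlongrightarrow> 0) (at_left ?b)"
    using tendsto_fst[OF tendsto_snd[OF es_0]] by (simp add: es_sig_def)
  have "((\<lambda>t. w i t - zstar S) \<longlongrightarrow> 0) (at_left ?b)"
    using tendsto_vec_nth[OF tendsto_fst[OF er_0], of i] by (simp add: er_sig_def)
  \<comment> \<open>The output error splits into the tracking error \<open>y - w\<close> and the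
    optimization error \<open>w - zstar S\<close>.\<close>
  from tendsto_add[OF yw_0 this] have y_0: "((\<lambda>t. y i t - zstar S) \<longlongrightarrow> 0) (at_left ?b)"
    by simp
  then have y_lim: "(y i \<longlongrightarrow> zstar S) (at_left ?b)" by (simp add: LIM_zero_iff)

  have "continuous_on (time_dom S) (x i)" "continuous_on (time_dom S) (y i)"
    using tr unfolding trajectory_def continuous_on_eq_continuous_within
    by (blast intro: has_vector_derivative_continuous)+
  then have xy: "bounded (x i ` time_dom S)" "bounded (y i ` time_dom S)"
    using bounded_if_left_limit x_0 y_lim unfolding time_dom_def by blast+

  have "norm (input_sig S x y v w p i t) \<le> \<gamma>ts i (sup_norm S ?est) + B"
    if t: "t \<in> time_dom S" for t
  proof -
    \<comment> \<open>\<open>Hu\<close> is prescribed only on values of \<open>trans_s\<close>, and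
      \<open>est_sig\<close> is such a value at each time.\<close>
    have "Hu i (?est t) (?er t) (gain S t) = input_sig S x y v w p i t"
      using transf gain_props(1)[OF S t]
      unfolding transformed_system_def est_sig_def u_of_sig[symmetric] by blast
    then have "norm (input_sig S x y v w p i t)
        \<le> \<gamma>ts i (sup_norm S ?est) + \<gamma>u i (gain S t) * norm (?er t)"
      using C3 tr est t unfolding cond_C3'_def by metis
    also have "\<gamma>u i (gain S t) * norm (?er t) \<le> B"
      using C3 by (intro gain_er[OF t]) (auto simp: cond_C3'_def)
    finally show ?thesis by simp
  qed
  then have "bounded (input_sig S x y v w p i ` time_dom S)"
    unfolding bounded_iff by blast
  with y_0 xy show "((\<lambda>t. y i t - zstar S) \<longlongrightarrow> 0) (at_left ?b)
      \<and> bounded (x i ` time_dom S) \<and> bounded (y i ` time_dom S)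
      \<and> bounded (input_sig S x y v w p i ` time_dom S)"
    by blast
qed

end
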